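(* Let $n\ge2$ be an integer and let $V=(V_1,\dots,V_{n-1})\in C([0,\infty);\mathbb{R}^{n-1})$. Then there exists a unique solution $(Z,\eta)$ to the Skorohod-type problem with reflection in $\mathbb{R}^{n-1}$ $$dZ(t)=n^2A^nZ(t)\,dt+d\eta(t),\qquad Z(t)\ge -V(t),\qquad \int_0^T\langle Z(t)+V(t),d\eta(t)\rangle=0\ \text{ for all }T>0.$$
   Context: $A^n=(A^n_{ki})$ is the $(n-1)\times(n-1)$ matrix with $A^n_{kk}=-2$, $A^n_{ki}=1$ if $|k-i|=1$, and $A^n_{ki}=0$ if $|k-i|>1$. For $a,b\in\mathbb{R}^{n-1}$, $a\ge b$ means $a_i\ge b_i$ for all $i$; $\langle\cdot,\cdot\rangle$ is the Euclidean inner product. A pair $(Z,\eta)$ is a solution of the problem if: (1) $Z=(Z_1,\dots,Z_{n-1})\in C([0,\infty);\mathbb{R}^{n-1})$ and $Z(t)\ge -V(t)$; (2) $\eta=(\eta_1,\dots,\eta_{n-1})\in C([0,\infty);\mathbb{R}^{n-1})$ and, for each $i$, $\eta_i(t)$ is an increasing continuous function with $\eta_i(0)=0$; (3) for all $t\ge0$, $Z(t)=\int_0^tn^2A^nZ(s)\,ds+\eta(t)$; (4) for all $t\ge0$, $\sum_{i=1}^{n-1}\int_0^t(Z_i(s)+V_i(s))\,\eta_i(ds)=0$.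
   Formalization: The formal theorem adds the hypothesis V(0) ≥ 0 componentwise; without it no solution exists, since conditions (2) and (3) force Z(0) = 0 while condition (1) requires Z(0) ≥ −V(0) (e.g. V ≡ −1). *)

theory Defs
  imports "HOL-Analysis.Analysis"
begin

text \<open>Vectors in \<open>\<real>\<^bsup>n-1\<^esup>\<close> are functions on the index set \<open>{1..n-1}\<close>. Paths are extensional in time and
  in the index, so that equality of paths is equality of functions on \<open>[0,\<infinity>)\<close>.\<close>

definition path_space :: "nat \<Rightarrow> (real \<Rightarrow> nat \<Rightarrow> real) set" where
  "path_space n = {f \<in> {0..} \<rightarrow>\<^sub>E ({1..n-1} \<rightarrow>\<^sub>E (UNIV :: real set)).
     \<forall>i\<in>{1..n-1}. continuous_on {0..} (\<lambda>t. f t i)}"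

text \<open>The entries do not depend on \<open>n\<close>; the size of the matrix enters through the range of
  summation in \<open>drift\<close>.\<close>

definition A_entry :: "nat \<Rightarrow> nat \<Rightarrow> real" where
  "A_entry k i = (if k = i then -2 else if \<bar>int k - int i\<bar> = 1 then 1 else 0)"

definition drift :: "nat \<Rightarrow> (nat \<Rightarrow> real) \<Rightarrow> nat \<Rightarrow> real" where
  "drift n z k = (real n)\<^sup>2 * (\<Sum>i=1..n-1. A_entry k i * z i)"

text \<open>The Lebesgue--Stieltjes measure of a path component on \<open>[0,\<infinity>)\<close>. As \<open>interval_measure\<close> needs a
  function on the whole line, the path is extended by its value at \<open>0\<close>, which puts no mass on
  \<open>(-\<infinity>,0]\<close>.\<close>

definition stieltjes :: "(real \<Rightarrow> real) \<Rightarrow> real measure" where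
  "stieltjes g = interval_measure (\<lambda>s. g (max 0 s))"

definition skorohod_solution ::
  "nat \<Rightarrow> (real \<Rightarrow> nat \<Rightarrow> real) \<Rightarrow> (real \<Rightarrow> nat \<Rightarrow> real) \<times> (real \<Rightarrow> nat \<Rightarrow> real) \<Rightarrow> bool" where
  "skorohod_solution n V = (\<lambda>(Z, \<eta>).
     Z \<in> path_space n \<and> (\<forall>t\<ge>0. \<forall>i\<in>{1..n-1}. Z t i \<ge> - V t i) \<and>
     \<eta> \<in> path_space n \<and> (\<forall>i\<in>{1..n-1}. mono_on {0..} (\<lambda>t. \<eta> t i) \<and> \<eta> 0 i = 0) \<and>
     (\<forall>t\<ge>0. \<forall>i\<in>{1..n-1}. Z t i = integral {0..t} (\<lambda>s. drift n (Z s) i) + \<eta> t i) \<and>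
     (\<forall>t\<ge>0. (\<Sum>i=1..n-1. LINT s:{0..t}|stieltjes (\<lambda>u. \<eta> u i). Z s i + V s i) = 0))"

text \<open>Solutions start at \<open>Z 0 = 0\<close>, so one can only exist if \<open>V 0 \<ge> 0\<close>.\<close>

lemma skorohod_solution_imp_initial_nonneg:
  assumes "skorohod_solution n V (Z, \<eta>)" "i \<in> {1..n-1}"
  shows "V 0 i \<ge> 0"
proof -
  have "Z 0 i \<ge> - V 0 i" "\<eta> 0 i = 0" "Z 0 i = integral {0..0} (\<lambda>s. drift n (Z s) i) + \<eta> 0 i"
    using assms unfolding skorohod_solution_def by auto
  then show ?thesis by simp
qed

end

theory Submission
  imports Defs "HOL-Probability.Discrete_Topology"
begin

text \<open>In one dimension, if \<open>Z = Y + \<eta>\<close> must stay above \<open>-V\<close>, then complementarity forces \<open>\<eta>\<close> to be the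
  running maximum of the positive part of \<open>X = -(Y + V)\<close>: an excess of \<open>\<eta>\<close> over it would have to grow while
  \<open>Z + V > 0\<close>. As the constraint \<open>Z \<ge> -V\<close> acts on each component separately, the solutions of the system are
  the fixed points of \<open>Z \<mapsto> Y + \<eta>\<close> with \<open>Y\<close> the integrated drift of \<open>Z\<close>. The running maximum is
  1-Lipschitz in the supremum norm, so this is a Volterra-type map, which contracts in an exponentially
  weighted supremum norm.\<close>

section \<open>Running maxima of continuous functions\<close>

text \<open>The adjoined \<open>0\<close> turns \<open>X\<close> into its positive part and gives the value \<open>0\<close> at negative times, so that
  the function is already extended to the whole line as in \<open>stieltjes\<close>.\<close>

definition running_max :: "(real \<Rightarrow> real) \<Rightarrow> real \<Rightarrow> real" where
  "running_max X t = Sup (insert 0 (X ` {0..t}))"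

lemma bdd_above_path:
  fixes X :: "real \<Rightarrow> real"
  assumes "continuous_on {0..} X"
  shows "bdd_above (insert 0 (X ` {0..t}))"
proof -
  have "continuous_on {0..t} X"
    using assms by (rule continuous_on_subset) auto
  then have "compact (X ` {0..t})"
    by (intro compact_continuous_image) auto
  then show ?thesis
    by (simp add: bounded_imp_bdd_above compact_imp_bounded)
qed

lemma running_max_upper:
  assumes "continuous_on {0..} X" "0 \<le> s" "s \<le> t"
  shows "X s \<le> running_max X t"
  unfolding running_max_def using assms by (intro cSup_upper bdd_above_path) auto

lemma running_max_nonneg:
  assumes "continuous_on {0..} X"
  shows "0 \<le> running_max X t"
  unfolding running_max_def using assms by (intro cSup_upper bdd_above_path) auto

lemma running_max_least:
  assumes "0 \<le> c" "\<And>s. 0 \<le> s \<Longrightarrow> s \<le> t \<Longrightarrow> X s \<le> c"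
  shows "running_max X t \<le> c"
  unfolding running_max_def using assms by (intro cSup_least) auto

lemma running_max_mono:
  assumes "continuous_on {0..} X" "s \<le> t"
  shows "running_max X s \<le> running_max X t"
  using assms by (intro running_max_least running_max_nonneg running_max_upper) auto

lemma running_max_eq_0:
  assumes "continuous_on {0..} X" "X 0 \<le> 0" "t \<le> 0"
  shows "running_max X t = 0"
proof (rule antisym)
  show "running_max X t \<le> 0"
  proof (rule running_max_least)
    fix s assume "0 \<le> s" "s \<le> t"
    then have "s = 0" using \<open>t \<le> 0\<close> by simp
    then show "X s \<le> 0" using \<open>X 0 \<le> 0\<close> by simp
  qed simp
qed (use assms running_max_nonneg in auto)

text \<open>If \<open>X\<close> stays within \<open>e\<close> of some value on
  \<open>{s..t}\<close>, it exceeds \<open>X s\<close> there by at most \<open>2 * e\<close>, so the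
  running maximum grows by no more than that. The condition \<open>X 0 \<le> 0\<close> rules out a
  jump from the value 0 held at negative times.\<close>

lemma continuous_on_running_max:
  assumes X: "continuous_on {0..} X" and "X 0 \<le> 0"
  shows "continuous_on UNIV (running_max X)"
proof -
  have step: "running_max X t \<le> running_max X s + 2 * e"
    if "0 \<le> s" "s \<le> t" "\<And>r. s \<le> r \<Longrightarrow> r \<le> t \<Longrightarrow> \<bar>X r - X c\<bar> \<le> e" for s t c e
  proof (rule running_max_least)
    have "0 \<le> e" using that(3)[of s] that(2) by linarith
    then show "0 \<le> running_max X s + 2 * e"
      using running_max_nonneg[OF X, of s] by linarith
    show "X r \<le> running_max X s + 2 * e" if "0 \<le> r" "r \<le> t" for r
    proof (cases "r \<le> s")
      case True
      then show ?thesis using running_max_upper[OF X \<open>0 \<le> r\<close> True] \<open>0 \<le> e\<close> by linarith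
    next
      case False
      then show ?thesis
        using running_max_upper[OF X \<open>0 \<le> s\<close> order_refl] \<open>s \<le> t\<close> \<open>r \<le> t\<close>
          \<open>\<And>r. s \<le> r \<Longrightarrow> r \<le> t \<Longrightarrow> \<bar>X r - X c\<bar> \<le> e\<close>[of r]
          \<open>\<And>r. s \<le> r \<Longrightarrow> r \<le> t \<Longrightarrow> \<bar>X r - X c\<bar> \<le> e\<close>[of s] by linarith
    qed
  qed
  have nonneg: "continuous_on {0..} (running_max X)"
    unfolding continuous_on_iff
  proof (intro ballI allI impI)
    fix t e :: real assume "t \<in> {0..}" "0 < e"
    then obtain d where d: "d > 0" "\<And>r. 0 \<le> r \<Longrightarrow> dist r t < d \<Longrightarrow> dist (X r) (X t) < e / 3"
      using X[unfolded continuous_on_iff, rule_format, of t "e / 3"] by auto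
    have close: "\<bar>X r - X t\<bar> \<le> e / 3" if "0 \<le> r" "\<bar>r - t\<bar> < d" for r
      using d(2)[of r] that by (simp add: dist_real_def)
    have "dist (running_max X s) (running_max X t) < e" if "s \<in> {0..}" "dist s t < d" for s
    proof (cases "s \<le> t")
      case True
      have "running_max X t \<le> running_max X s + 2 * (e / 3)"
        using that True by (intro step[of s t t] close) (auto simp: dist_real_def)
      then show ?thesis
        using running_max_mono[OF X True] \<open>0 < e\<close> by (simp add: dist_real_def)
    next
      case False
      have "running_max X s \<le> running_max X t + 2 * (e / 3)"
        using that False \<open>t \<in> {0..}\<close> by (intro step[of t s t] close) (auto simp: dist_real_def)
      then show ?thesis
        using running_max_mono[OF X, of t s] False \<open>0 < e\<close> by (simp add: dist_real_def)
    qed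
    then show "\<exists>d>0. \<forall>s\<in>{0..}. dist s t < d \<longrightarrow> dist (running_max X s) (running_max X t) < e"
      using d(1) by blast
  qed
  have "continuous_on ({..0} \<union> {0..}) (running_max X)"
  proof (intro continuous_on_closed_Un nonneg)
    show "continuous_on {..0} (running_max X)"
      by (rule continuous_on_eq[OF continuous_on_const[of _ 0]])
        (use running_max_eq_0[OF X \<open>X 0 \<le> 0\<close>] in auto)
  qed auto
  moreover have "{..0} \<union> {0..} = (UNIV :: real set)" by auto
  ultimately show ?thesis by simp
qed

text \<open>Adding \<open>c\<close> to one running maximum gives an upper bound for the other
  function; the roles are then exchanged.\<close>

lemma running_max_diff_le:
  assumes X: "continuous_on {0..} X" and Y: "continuous_on {0..} Y" and "0 \<le> c"
    and "\<And>s. 0 \<le> s \<Longrightarrow> s \<le> t \<Longrightarrow> \<bar>X s - Y s\<bar> \<le> c"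
  shows "\<bar>running_max X t - running_max Y t\<bar> \<le> c"
proof -
  have *: "running_max X t \<le> running_max Y t + c"
    if "continuous_on {0..} Y" "\<And>s. 0 \<le> s \<Longrightarrow> s \<le> t \<Longrightarrow> \<bar>X s - Y s\<bar> \<le> c" for X Y
  proof (rule running_max_least)
    show "0 \<le> running_max Y t + c"
      using running_max_nonneg[OF that(1), of t] \<open>0 \<le> c\<close> by simp
    show "X s \<le> running_max Y t + c" if "0 \<le> s" "s \<le> t" for s
      using running_max_upper[OF \<open>continuous_on {0..} Y\<close> that] \<open>\<And>s. 0 \<le> s \<Longrightarrow> s \<le> t \<Longrightarrow> \<bar>X s - Y s\<bar> \<le> c\<close>[OF that]
      by linarith
  qed
  have "\<bar>Y s - X s\<bar> \<le> c" if "0 \<le> s" "s \<le> t" for s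
    using assms(4)[OF that] by (simp add: abs_minus_commute)
  then have "running_max Y t \<le> running_max X t + c"
    by (intro *[OF X]) auto
  moreover have "running_max X t \<le> running_max Y t + c"
    using assms(4) by (intro *[OF Y]) auto
  ultimately show ?thesis by linarith
qed

text \<open>This is why the Stieltjes measure of the running maximum is carried by the contact set
  \<open>{s. X s = running_max X s}\<close>.\<close>

lemma running_max_locally_const:
  assumes X: "continuous_on {0..} X" "X 0 \<le> 0" and s: "0 \<le> s" "X s < running_max X s"
  obtains p q where "p \<in> \<rat>" "q \<in> \<rat>" "p < s" "s < q" "running_max X p = running_max X q"
proof -
  \<comment> \<open>A level strictly between \<open>X\<close> and the running maximum at
    \<open>s\<close>; by continuity it still separates the two near \<open>s\<close>.\<close>
  define c where "c = (X s + running_max X s) / 2"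
  have c: "X s < c" "c < running_max X s" using s by (auto simp: c_def)
  obtain d where d: "d > 0" "\<And>r. 0 \<le> r \<Longrightarrow> dist r s < d \<Longrightarrow> dist (X r) (X s) < c - X s"
    using X(1)[unfolded continuous_on_iff, rule_format, of s "c - X s"] c s by auto
  obtain d' where d': "d' > 0"
    "\<And>r. dist r s < d' \<Longrightarrow> dist (running_max X r) (running_max X s) < running_max X s - c"
    using continuous_on_running_max[OF X, unfolded continuous_on_iff, rule_format, of s "running_max X s - c"] c
    by auto
  \<comment> \<open>Rational endpoints leave only countably many intervals to consider. For small
    \<open>s\<close> the point \<open>p\<close> may be negative, where the running maximum is
    0.\<close>
  obtain p where p: "p \<in> \<rat>" "s - min d d' < p" "p < s"
    using Rats_dense_in_real[of "s - min d d'" s] d(1) d'(1) by auto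
  obtain q where q: "q \<in> \<rat>" "s < q" "q < s + min d d'"
    using Rats_dense_in_real[of s "s + min d d'"] d(1) d'(1) by auto
  have "dist p s < d'" using p by (simp add: dist_real_def)
  from d'(2)[OF this] have cp: "c < running_max X p"
    unfolding dist_real_def by linarith
  \<comment> \<open>Between \<open>p\<close> and \<open>q\<close> the values of \<open>X\<close>
    stay below \<open>c\<close>, which is already below the running maximum at
    \<open>p\<close>.\<close>
  have "running_max X q \<le> running_max X p"
  proof (rule running_max_least[OF running_max_nonneg[OF X(1)]])
    fix r assume r: "0 \<le> r" "r \<le> q"
    show "X r \<le> running_max X p"
    proof (cases "r \<le> p")
      case True
      then show ?thesis using running_max_upper[OF X(1) r(1)] by blast
    next
      case False
      then have "dist r s < d" using r p q by (auto simp: dist_real_def)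
      then show ?thesis using d(2)[OF r(1)] cp by (simp add: dist_real_def)
    qed
  qed
  then have "running_max X p = running_max X q"
    using running_max_mono[OF X(1), of p q] p q by auto
  then show ?thesis using that p q by blast
qed

section \<open>Stieltjes measures and the one-dimensional Skorohod problem\<close>

text \<open>Extending \<open>g\<close> constantly to the left of 0 keeps it nondecreasing and
  continuous, which is what \<open>interval_measure\<close> needs to give intervals their expected
  mass.\<close>

lemma
  assumes mono: "mono_on {0..} g" and cont: "continuous_on {0..} g"
  shows sets_stieltjes [simp, measurable_cong]: "sets (stieltjes g) = sets borel"
    and emeasure_stieltjes_Ioc:
      "a \<le> b \<Longrightarrow> emeasure (stieltjes g) {a<..b} = ennreal (g (max 0 b) - g (max 0 a))"
proof -
  have "continuous_on UNIV (\<lambda>s. g (max 0 s))"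
    by (intro continuous_on_compose2[OF cont] continuous_intros) auto
  then have "continuous (at_right a) (\<lambda>s. g (max 0 s))" for a
    by (metis continuous_at_imp_continuous_at_within continuous_on_eq_continuous_at iso_tuple_UNIV_I open_UNIV)
  moreover have "g (max 0 x) \<le> g (max 0 y)" if "x \<le> y" for x y
    using that by (intro mono_onD[OF mono]) auto
  ultimately show "a \<le> b \<Longrightarrow> emeasure (stieltjes g) {a<..b} = ennreal (g (max 0 b) - g (max 0 a))"
    unfolding stieltjes_def by (subst emeasure_interval_measure_Ioc) auto
  show "sets (stieltjes g) = sets borel" by (simp add: stieltjes_def)
qed

lemma set_integrable_stieltjes:
  assumes mono: "mono_on {0..} g" and cont: "continuous_on {0..} g"
    and f: "continuous_on {0..} (f :: real \<Rightarrow> real)"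
  shows "set_integrable (stieltjes g) {0..t} f"
proof -
  have f': "continuous_on {0..t} f"
    using f by (rule continuous_on_subset) auto
  then have "bounded (f ` {0..t})"
    by (intro compact_imp_bounded compact_continuous_image) auto
  then obtain B where B: "\<forall>x\<in>{0..t}. \<bar>f x\<bar> \<le> B"
    unfolding bounded_iff by auto
  \<comment> \<open>The negative left end brings the point 0 into the half-open interval, and
    \<open>max 0 t\<close> keeps its ends in order when \<open>t\<close> is negative.\<close>
  have "emeasure (stieltjes g) {0..t} \<le> emeasure (stieltjes g) {-1<..max 0 t}"
    by (rule emeasure_mono) (auto simp: sets_stieltjes[OF mono cont])
  also have "\<dots> < \<infinity>"
    by (subst emeasure_stieltjes_Ioc[OF mono cont]) auto
  finally have fin: "emeasure (stieltjes g) {0..t} < \<infinity>" .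
  have "(\<lambda>x. indicator {0..t} x *\<^sub>R f x) \<in> borel_measurable borel"
    using f' by (intro borel_measurable_continuous_on_indicator) auto
  then have meas: "(\<lambda>x. indicator {0..t} x *\<^sub>R f x) \<in> borel_measurable (stieltjes g)"
    by (simp add: measurable_cong_sets[OF sets_stieltjes[OF mono cont] refl])
  show ?thesis
    unfolding set_integrable_def
    by (rule integrableI_bounded_set[where A = "{0..t}" and B = B])
      (use fin meas B in \<open>auto simp: sets_stieltjes[OF mono cont]\<close>)
qed

text \<open>Turns complementarity into a statement about null sets, so that no integral has to be
  evaluated.\<close>

lemma set_integral_stieltjes_eq_0_iff:
  assumes mono: "mono_on {0..} g" and cont: "continuous_on {0..} g"
    and f: "continuous_on {0..} (f :: real \<Rightarrow> real)" "\<And>s. 0 \<le> s \<Longrightarrow> 0 \<le> f s"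
  shows "(LINT s:{0..t}|stieltjes g. f s) = 0 \<longleftrightarrow> (AE s in stieltjes g. s \<in> {0..t} \<longrightarrow> f s = 0)"
proof -
  have "(LINT s:{0..t}|stieltjes g. f s) = 0 \<longleftrightarrow>
      (AE s in stieltjes g. indicator {0..t} s *\<^sub>R f s = 0)"
    unfolding set_lebesgue_integral_def
    using set_integrable_stieltjes[OF mono cont f(1), of t] f(2)
    by (intro integral_nonneg_eq_0_iff_AE) (auto simp: set_integrable_def indicator_def)
  also have "(\<lambda>s. indicator {0..t} s *\<^sub>R f s = 0) = (\<lambda>s. s \<in> {0..t} \<longrightarrow> f s = 0)"
    by (auto simp: indicator_def fun_eq_iff)
  finally show ?thesis .
qed

text \<open>Each point of \<open>{0..t}\<close> off the contact set lies in an interval with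
  rational ends on which the running maximum does not grow. Countably many such intervals, each of
  mass zero, form a null set.\<close>

lemma AE_stieltjes_running_max:
  assumes X: "continuous_on {0..} X" "X 0 \<le> 0" and g: "\<And>t. 0 \<le> t \<Longrightarrow> g t = running_max X t"
  shows "AE s in stieltjes g. s \<in> {0..t} \<longrightarrow> g s - X s = 0"
proof -
  have mono: "mono_on {0..} g"
    using running_max_mono[OF X(1)] by (intro mono_onI) (auto simp: g)
  have "continuous_on {0..} (running_max X)"
    using continuous_on_running_max[OF X] by (rule continuous_on_subset) auto
  then have cont: "continuous_on {0..} g"
    by (rule continuous_on_eq) (auto simp: g)
  \<comment> \<open>The running maximum vanishes at nonpositive times, so it is the extension of
    \<open>g\<close> on which \<open>stieltjes\<close> is built.\<close>
  have ext: "g (max 0 s) = running_max X s" for s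
    using running_max_eq_0[OF X, of s] running_max_eq_0[OF X, of 0] by (cases "s \<le> 0") (auto simp: g max_def)
  define J where "J = {(p, q). p \<in> \<rat> \<and> q \<in> \<rat> \<and> p \<le> q \<and> running_max X p = running_max X q}"
  have "countable J"
    by (rule countable_subset[of _ "\<rat> \<times> \<rat>"]) (auto simp: J_def countable_rat)
  then have "(\<Union>(p, q)\<in>J. {p<..q}) \<in> null_sets (stieltjes g)"
    by (intro null_sets_UN') (auto intro!: null_setsI
        simp: J_def emeasure_stieltjes_Ioc[OF mono cont] ext sets_stieltjes[OF mono cont])
  then show ?thesis
  proof (rule AE_I', intro subsetI)
    fix s assume "s \<in> {s \<in> space (stieltjes g). \<not> (s \<in> {0..t} \<longrightarrow> g s - X s = 0)}"
    then have s: "s \<in> {0..t}" "g s - X s \<noteq> 0" by auto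
    then have "X s < running_max X s"
      using running_max_upper[OF X(1), of s s] g[of s] by auto
    then obtain p q where "p \<in> \<rat>" "q \<in> \<rat>" "p < s" "s < q" "running_max X p = running_max X q"
      using running_max_locally_const[OF X, of s] s by auto
    then have "(p, q) \<in> J" "s \<in> {p<..q}" by (auto simp: J_def)
    then show "s \<in> (\<Union>(p, q)\<in>J. {p<..q})" by blast
  qed
qed

text \<open>Being monotone, nonnegative and above \<open>X\<close>, the function \<open>g\<close>
  dominates the running maximum. If it were strictly larger at \<open>t\<close>, then
  \<open>{s..t}\<close> for a suitable \<open>s\<close> would carry mass although the gap
  \<open>g - X\<close> is positive there.\<close>

lemma running_max_unique:
  assumes X: "continuous_on {0..} X" "X 0 \<le> 0"
    and g: "mono_on {0..} g" "continuous_on {0..} g" "g 0 = 0" "\<And>s. 0 \<le> s \<Longrightarrow> X s \<le> g s"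
    and AE: "AE s in stieltjes g. s \<in> {0..t} \<longrightarrow> g s - X s = 0" and "0 \<le> t"
  shows "g t = running_max X t"
proof (rule antisym)
  have "X s \<le> g t" if "0 \<le> s" "s \<le> t" for s
    using g(4)[OF that(1)] mono_onD[OF g(1), of s t] that by force
  then show "running_max X t \<le> g t"
    using mono_onD[OF g(1), of 0 t] \<open>0 \<le> t\<close> g(3) by (intro running_max_least) auto
  show "g t \<le> running_max X t"
  proof (rule ccontr)
    assume "\<not> g t \<le> running_max X t"
    then have less: "running_max X t < g t" by simp
    have cont: "continuous_on {0..t} g"
      using g(2) by (rule continuous_on_subset) auto
    \<comment> \<open>At the midpoint level, \<open>g\<close> has still to grow on
      \<open>{s<..t}\<close> while it lies above every value of \<open>X\<close> up to time
      \<open>t\<close>.\<close>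
    obtain s where s: "0 \<le> s" "s \<le> t" "g s = (running_max X t + g t) / 2"
      using IVT'[of g 0 "(running_max X t + g t) / 2" t, OF _ _ \<open>0 \<le> t\<close> cont]
        running_max_nonneg[OF X(1), of t] g(3) less by (auto simp: field_simps)
    have "AE r in stieltjes g. r \<notin> {s<..t}"
      using AE
    proof (rule AE_mp, intro AE_I2 impI notI)
      fix r assume r: "r \<in> {0..t} \<longrightarrow> g r - X r = 0" "r \<in> {s<..t}"
      then have "g s \<le> g r" "X r \<le> running_max X t"
        using mono_onD[OF g(1), of s r] running_max_upper[OF X(1), of r t] s by auto
      then show False using r s less by (auto simp: field_simps)
    qed
    then have "emeasure (stieltjes g) {s<..t} = 0"
      by (subst (asm) AE_iff_measurable[of "{s<..t}"])
        (auto simp: sets_stieltjes[OF g(1,2)] stieltjes_def)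
    then show False
      using s less \<open>0 \<le> t\<close> by (simp add: emeasure_stieltjes_Ioc[OF g(1,2)] field_simps)
  qed
qed

text \<open>In the application \<open>g - X\<close> is \<open>Z + V\<close>, so this trades
  complementarity for an explicit formula for the reflection term.\<close>

lemma skorohod_1d:
  assumes X: "continuous_on {0..} X" "X 0 \<le> 0"
    and g: "mono_on {0..} g" "continuous_on {0..} g" "g 0 = 0" "\<And>s. 0 \<le> s \<Longrightarrow> X s \<le> g s"
  shows "(\<forall>t\<ge>0. (LINT s:{0..t}|stieltjes g. g s - X s) = 0) \<longleftrightarrow> (\<forall>t\<ge>0. g t = running_max X t)"
proof -
  have "(LINT s:{0..t}|stieltjes g. g s - X s) = 0 \<longleftrightarrow>
      (AE s in stieltjes g. s \<in> {0..t} \<longrightarrow> g s - X s = 0)" for t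
    using assms by (intro set_integral_stieltjes_eq_0_iff continuous_intros) auto
  then show ?thesis
    using running_max_unique[OF assms] AE_stieltjes_running_max[OF X, of g] by blast
qed

section \<open>Lipschitz bound and continuity of the drift\<close>

text \<open>The constant collects the square of \<open>n\<close> in front of the sum, fewer than
  \<open>n\<close> summands, and entries of modulus at most 2.\<close>

lemma abs_drift_diff_le:
  assumes "\<And>j. j \<in> {1..n-1} \<Longrightarrow> \<bar>x j - y j\<bar> \<le> c" "0 \<le> c"
  shows "\<bar>drift n x i - drift n y i\<bar> \<le> 2 * real n ^ 3 * c"
proof -
  have "drift n x i - drift n y i = (real n)\<^sup>2 * (\<Sum>j=1..n-1. A_entry i j * (x j - y j))"
    by (simp add: drift_def algebra_simps sum_subtractf)
  also have "\<bar>\<dots>\<bar> = (real n)\<^sup>2 * \<bar>\<Sum>j=1..n-1. A_entry i j * (x j - y j)\<bar>"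
    by (simp add: abs_mult)
  also have "\<dots> \<le> (real n)\<^sup>2 * (\<Sum>j=1..n-1. 2 * c)"
  proof (intro mult_left_mono order.trans[OF sum_abs] sum_mono)
    fix j assume "j \<in> {1..n-1}"
    have "\<bar>A_entry i j\<bar> \<le> 2" by (simp add: A_entry_def)
    then show "\<bar>A_entry i j * (x j - y j)\<bar> \<le> 2 * c"
      unfolding abs_mult using assms(1)[OF \<open>j \<in> _\<close>] by (intro mult_mono) auto
  qed simp
  also have "\<dots> \<le> (real n)\<^sup>2 * (real n * (2 * c))"
    using \<open>0 \<le> c\<close> by (intro mult_left_mono) (auto intro!: mult_right_mono)
  finally show ?thesis by (simp add: power2_eq_square power3_eq_cube mult_ac)
qed

lemma continuous_on_atLeast_if_compact:
  fixes f :: "real \<Rightarrow> 'a::metric_space"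
  assumes "\<And>b. a \<le> b \<Longrightarrow> continuous_on {a..b} f"
  shows "continuous_on {a..} f"
  unfolding continuous_on_iff
proof (intro ballI allI impI)
  fix t and e :: real assume t: "t \<in> {a..}" "0 < e"
  then have "continuous_on {a..t+1} f" by (intro assms) auto
  then obtain d where "d > 0" "\<And>s. s \<in> {a..t+1} \<Longrightarrow> dist s t < d \<Longrightarrow> dist (f s) (f t) < e"
    unfolding continuous_on_iff using t by (metis add_increasing2 atLeastAtMost_iff atLeast_iff order_refl zero_le_one)
  \<comment> \<open>Capping the radius at 1 keeps all points inside \<open>{a..t+1}\<close>.\<close>
  then show "\<exists>d>0. \<forall>s\<in>{a..}. dist s t < d \<longrightarrow> dist (f s) (f t) < e"
    by (intro exI[of _ "min d 1"]) (auto simp: dist_real_def abs_less_iff)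
qed

lemma continuous_on_drift:
  assumes "\<And>j. j \<in> {1..n-1} \<Longrightarrow> continuous_on S (\<lambda>t. u t j)"
  shows "continuous_on S (\<lambda>t. drift n (u t) i)"
  unfolding drift_def using assms by (intro continuous_intros) auto

section \<open>Reduction of the system to a fixed-point equation\<close>

locale skorohod_problem =
  fixes n :: nat and V :: "real \<Rightarrow> nat \<Rightarrow> real"
  assumes n: "n \<ge> 2" and V: "V \<in> path_space n" and V0: "i \<in> {1..n-1} \<Longrightarrow> V 0 i \<ge> 0"
begin

text \<open>Continuity without the extensionality of \<open>path_space\<close>, so that paths built
  as total functions qualify.\<close>

definition cont :: "(real \<Rightarrow> nat \<Rightarrow> real) \<Rightarrow> bool" where
  "cont u \<longleftrightarrow> (\<forall>i\<in>{1..n-1}. continuous_on {0..} (\<lambda>t. u t i))"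

definition drift_int :: "(real \<Rightarrow> nat \<Rightarrow> real) \<Rightarrow> nat \<Rightarrow> real \<Rightarrow> real" where
  "drift_int u i t = integral {0..t} (\<lambda>s. drift n (u s) i)"

text \<open>The \<open>X\<close> of the one-dimensional problem:
  \<open>Z = drift_int Z + \<eta>\<close> satisfies \<open>Z \<ge> -V\<close> exactly if
  \<open>\<eta>\<close> lies above it.\<close>

definition obstacle :: "(real \<Rightarrow> nat \<Rightarrow> real) \<Rightarrow> nat \<Rightarrow> real \<Rightarrow> real" where
  "obstacle u i t = - (drift_int u i t + V t i)"

definition reflected :: "(real \<Rightarrow> nat \<Rightarrow> real) \<Rightarrow> nat \<Rightarrow> real \<Rightarrow> real" where
  "reflected u i t = drift_int u i t + running_max (obstacle u i) t"

text \<open>Four times the Lipschitz constant of the drift, so that integration in the exponentially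
  weighted norm gains a factor 1/4.\<close>

definition rate :: real where
  "rate = 8 * real n ^ 3"

definition restrict_path :: "(real \<Rightarrow> nat \<Rightarrow> real) \<Rightarrow> real \<Rightarrow> nat \<Rightarrow> real" where
  "restrict_path u = (\<lambda>t\<in>{0..}. \<lambda>i\<in>{1..n-1}. u t i)"

lemma rate_pos: "rate > 0"
  using n by (simp add: rate_def)

lemma cont_path_space: "u \<in> path_space n \<Longrightarrow> cont u"
  by (auto simp: path_space_def cont_def)

lemma cont_subset:
  "cont u \<Longrightarrow> i \<in> {1..n-1} \<Longrightarrow> S \<subseteq> {0..} \<Longrightarrow> continuous_on S (\<lambda>t. u t i)"
  unfolding cont_def using continuous_on_subset by blast

lemma restrict_path_apply [simp]:
  "0 \<le> t \<Longrightarrow> i \<in> {1..n-1} \<Longrightarrow> restrict_path u t i = u t i"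
  by (simp add: restrict_path_def)

lemma restrict_path_in_path_space:
  assumes "cont u"
  shows "restrict_path u \<in> path_space n"
proof -
  have "continuous_on {0..} (\<lambda>t. restrict_path u t i)" if "i \<in> {1..n-1}" for i
    by (rule continuous_on_eq[of _ "\<lambda>t. u t i"]) (use assms that in \<open>auto simp: cont_def\<close>)
  moreover have "restrict_path u \<in> {0..} \<rightarrow>\<^sub>E ({1..n-1} \<rightarrow>\<^sub>E UNIV)"
    by (auto simp: restrict_path_def)
  ultimately show ?thesis
    unfolding path_space_def by blast
qed

lemma path_space_eqI:
  assumes "u \<in> path_space n" "v \<in> path_space n"
    and "\<And>t i. 0 \<le> t \<Longrightarrow> i \<in> {1..n-1} \<Longrightarrow> u t i = v t i"
  shows "u = v"
proof -
  have u: "u \<in> {0..} \<rightarrow>\<^sub>E ({1..n-1} \<rightarrow>\<^sub>E UNIV)" and v: "v \<in> {0..} \<rightarrow>\<^sub>E ({1..n-1} \<rightarrow>\<^sub>E UNIV)"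
    using assms(1,2) unfolding path_space_def by blast+
  show ?thesis
  proof (rule PiE_ext[OF u v])
    fix t :: real assume t: "t \<in> {0..}"
    show "u t = v t"
      using PiE_mem[OF u t] PiE_mem[OF v t] by (rule PiE_ext) (use t assms(3) in auto)
  qed
qed

lemma drift_cong:
  assumes "\<And>j. j \<in> {1..n-1} \<Longrightarrow> x j = y j"
  shows "drift n x i = drift n y i"
  unfolding drift_def using assms by (auto intro!: sum.cong)

lemma drift_int_cong:
  assumes "\<And>t i. 0 \<le> t \<Longrightarrow> i \<in> {1..n-1} \<Longrightarrow> u t i = v t i"
  shows "drift_int u = drift_int v"
  unfolding drift_int_def using assms by (intro ext integral_cong drift_cong) auto

lemma obstacle_cong:
  assumes "\<And>t i. 0 \<le> t \<Longrightarrow> i \<in> {1..n-1} \<Longrightarrow> u t i = v t i"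
  shows "obstacle u = obstacle v"
  unfolding obstacle_def using drift_int_cong[of u v] assms by simp

lemma drift_int_0 [simp]: "drift_int u i 0 = 0"
  by (simp add: drift_int_def)

lemma drift_integrable: "cont u \<Longrightarrow> (\<lambda>s. drift n (u s) i) integrable_on {0..t}"
  by (intro integrable_continuous_real continuous_on_drift cont_subset) auto

lemma continuous_on_drift_int:
  assumes "cont u"
  shows "continuous_on {0..} (drift_int u i)"
  unfolding drift_int_def
  by (intro continuous_on_atLeast_if_compact indefinite_integral_continuous_1 drift_integrable assms)

text \<open>The sign condition on \<open>V 0\<close> enters through \<open>obstacle_0\<close>; it
  lets the reflection term start at 0.\<close>

lemma
  assumes u: "cont u" and i: "i \<in> {1..n-1}"
  shows continuous_on_obstacle: "continuous_on {0..} (obstacle u i)"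
    and obstacle_0: "obstacle u i 0 \<le> 0"
proof -
  show "continuous_on {0..} (obstacle u i)"
    unfolding obstacle_def using continuous_on_drift_int[OF u] cont_path_space[OF V] i
    by (intro continuous_intros) (auto simp: cont_def)
  show "obstacle u i 0 \<le> 0"
    using V0[OF i] by (simp add: obstacle_def)
qed

lemma continuous_on_running_max_obstacle:
  assumes u: "cont u" and i: "i \<in> {1..n-1}"
  shows "continuous_on {0..} (running_max (obstacle u i))"
  using continuous_on_running_max[OF continuous_on_obstacle[OF assms] obstacle_0[OF assms]]
  by (rule continuous_on_subset) auto

lemma
  assumes u: "cont u" and i: "i \<in> {1..n-1}"
  shows continuous_on_reflected: "continuous_on {0..} (reflected u i)"
    and reflected_0: "reflected u i 0 = 0"
proof -
  show "continuous_on {0..} (reflected u i)"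
    unfolding reflected_def
    by (intro continuous_intros continuous_on_drift_int continuous_on_running_max_obstacle u i)
  show "reflected u i 0 = 0"
    using running_max_eq_0[OF continuous_on_obstacle[OF assms] obstacle_0[OF assms]]
    by (simp add: reflected_def)
qed

text \<open>Componentwise this is \<open>skorohod_1d\<close> with the obstacle as \<open>X\<close>.
  The drift couples the components only through \<open>obstacle Z\<close>, which leaves a
  fixed-point equation for \<open>Z\<close> alone, with \<open>\<eta>\<close> determined by
  \<open>Z\<close>.\<close>

lemma skorohod_solution_iff:
  "skorohod_solution n V (Z, \<eta>) \<longleftrightarrow> Z \<in> path_space n \<and> \<eta> \<in> path_space n \<and>
     (\<forall>t\<ge>0. \<forall>i\<in>{1..n-1}. \<eta> t i = running_max (obstacle Z i) t \<and> Z t i = reflected Z i t)"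
  (is "_ \<longleftrightarrow> ?R")
proof (cases "Z \<in> path_space n \<and> \<eta> \<in> path_space n")
  case True
  then have Z: "cont Z" and \<eta>: "cont \<eta>" by (auto intro: cont_path_space)
  note X = continuous_on_obstacle[OF Z] obstacle_0[OF Z]
  have \<eta>': "continuous_on {0..} (\<lambda>t. \<eta> t i)" if "i \<in> {1..n-1}" for i
    using \<eta> that by (auto simp: cont_def)
  let ?gap = "\<lambda>i s. \<eta> s i - obstacle Z i s"
  let ?int = "\<lambda>t i f. LINT s:{0..t}|stieltjes (\<lambda>u. \<eta> u i). f s"
  \<comment> \<open>The two integrands agree only at nonnegative times, so the comparison is made
    under the indicator of \<open>{0..t}\<close>.\<close>
  have compl: "?int t i (\<lambda>s. Z s i + V s i) = ?int t i (?gap i)"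
    if "\<forall>t\<ge>0. \<forall>i\<in>{1..n-1}. Z t i = drift_int Z i t + \<eta> t i" "i \<in> {1..n-1}" for t i
    unfolding set_lebesgue_integral_def using that
    by (intro Bochner_Integration.integral_cong) (auto simp: indicator_def obstacle_def)
  show ?thesis
  proof
    assume sol: "skorohod_solution n V (Z, \<eta>)"
    then have eq: "\<forall>t\<ge>0. \<forall>i\<in>{1..n-1}. Z t i = drift_int Z i t + \<eta> t i"
      and ge: "\<forall>t\<ge>0. \<forall>i\<in>{1..n-1}. Z t i \<ge> - V t i"
      and mono: "\<And>i. i \<in> {1..n-1} \<Longrightarrow> mono_on {0..} (\<lambda>t. \<eta> t i)"
      and \<eta>0: "\<And>i. i \<in> {1..n-1} \<Longrightarrow> \<eta> 0 i = 0"
      and sum0: "\<And>t. 0 \<le> t \<Longrightarrow> (\<Sum>i=1..n-1. ?int t i (\<lambda>s. Z s i + V s i)) = 0"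
      unfolding skorohod_solution_def drift_int_def by auto
    have gap: "obstacle Z i s \<le> \<eta> s i" if "0 \<le> s" "i \<in> {1..n-1}" for i s
    proof -
      have "- V s i \<le> drift_int Z i s + \<eta> s i" using eq ge that by metis
      then show ?thesis by (simp add: obstacle_def)
    qed
    \<comment> \<open>Only the sum of the integrals is assumed to vanish; as every gap is
      nonnegative, each summand vanishes too.\<close>
    have "?int t i (?gap i) = 0" if "0 \<le> t" "i \<in> {1..n-1}" for t i
    proof -
      have "(\<Sum>i=1..n-1. ?int t i (?gap i)) = 0"
        using sum0[OF \<open>0 \<le> t\<close>] compl[OF eq] by simp
      moreover have "?int t j (?gap j) \<ge> 0" if "j \<in> {1..n-1}" for j
        unfolding set_lebesgue_integral_def using gap[OF _ that]
        by (intro Bochner_Integration.integral_nonneg) (auto simp: indicator_def)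
      ultimately show ?thesis
        using that(2) by (subst (asm) sum_nonneg_eq_0_iff) auto
    qed
    then have "\<forall>t\<ge>0. \<eta> t i = running_max (obstacle Z i) t" if "i \<in> {1..n-1}" for i
      using that skorohod_1d[OF X[OF that] mono[OF that] \<eta>'[OF that] \<eta>0[OF that] gap] by simp
    then show ?R
      using True eq by (auto simp: reflected_def)
  next
    assume R: ?R
    have eq: "\<forall>t\<ge>0. \<forall>i\<in>{1..n-1}. Z t i = drift_int Z i t + \<eta> t i"
      using R by (auto simp: reflected_def)
    have mono: "mono_on {0..} (\<lambda>t. \<eta> t i)" if "i \<in> {1..n-1}" for i
      using R that running_max_mono[OF X(1)[OF that]] by (intro mono_onI) auto
    have \<eta>0: "\<eta> 0 i = 0" if "i \<in> {1..n-1}" for i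
      using R that running_max_eq_0[OF X[OF that]] by auto
    have gap: "obstacle Z i s \<le> \<eta> s i" if "0 \<le> s" "i \<in> {1..n-1}" for i s
      using R that running_max_upper[OF X(1), of i s s] by auto
    have "- V t i \<le> Z t i" if "0 \<le> t" "i \<in> {1..n-1}" for t i
    proof -
      have "Z t i = drift_int Z i t + \<eta> t i" using eq that by blast
      then show ?thesis using gap[OF that] by (simp add: obstacle_def)
    qed
    moreover have "?int t i (\<lambda>s. Z s i + V s i) = 0" if "0 \<le> t" "i \<in> {1..n-1}" for t i
      using R that skorohod_1d[OF X[OF that(2)] mono[OF that(2)] \<eta>'[OF that(2)] \<eta>0[OF that(2)] gap]
        compl[OF eq that(2)] by simp
    ultimately show "skorohod_solution n V (Z, \<eta>)"
      using True mono \<eta>0 eq unfolding skorohod_solution_def drift_int_def by auto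
  qed
qed (auto simp: skorohod_solution_def)

section \<open>Contraction estimate and uniqueness\<close>

text \<open>The pointwise Lipschitz bound is the derivative of
  \<open>K * exp (rate * s) / 4\<close>, because \<open>rate\<close> is four times the Lipschitz
  constant.\<close>

lemma abs_drift_int_diff_le:
  assumes u: "cont u" and v: "cont v" and "0 \<le> K" "0 \<le> t"
    and le: "\<And>s j. 0 \<le> s \<Longrightarrow> s \<le> t \<Longrightarrow> j \<in> {1..n-1} \<Longrightarrow> \<bar>u s j - v s j\<bar> \<le> K * exp (rate * s)"
  shows "\<bar>drift_int u i t - drift_int v i t\<bar> \<le> K * exp (rate * t) / 4"
proof -
  let ?F = "\<lambda>s. K * exp (rate * s) / 4"
  have F: "((\<lambda>s. 2 * real n ^ 3 * (K * exp (rate * s))) has_integral ?F t - ?F 0) {0..t}"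
    by (rule fundamental_theorem_of_calculus[OF \<open>0 \<le> t\<close>])
      (auto intro!: derivative_eq_intros simp: has_real_derivative_iff_has_vector_derivative[symmetric] rate_def)
  have "drift_int u i t - drift_int v i t = integral {0..t} (\<lambda>s. drift n (u s) i - drift n (v s) i)"
    unfolding drift_int_def by (simp add: integral_diff drift_integrable u v)
  also have "norm \<dots> \<le> integral {0..t} (\<lambda>s. 2 * real n ^ 3 * (K * exp (rate * s)))"
  proof (rule integral_norm_bound_integral)
    show "(\<lambda>s. drift n (u s) i - drift n (v s) i) integrable_on {0..t}"
      by (intro integrable_diff drift_integrable u v)
    show "norm (drift n (u s) i - drift n (v s) i) \<le> 2 * real n ^ 3 * (K * exp (rate * s))"
      if "s \<in> {0..t}" for s
      unfolding real_norm_def using that le \<open>0 \<le> K\<close> by (intro abs_drift_diff_le) auto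
  qed (use F in blast)
  also have "\<dots> = ?F t - ?F 0" using F by (rule integral_unique)
  finally show ?thesis using \<open>0 \<le> K\<close> by simp
qed

text \<open>The integrated drift contributes one quarter. The obstacles differ by that integrated
  drift alone, and the running maximum is 1-Lipschitz, which gives the other quarter.\<close>

lemma abs_reflected_diff_le:
  assumes u: "cont u" and v: "cont v" and "0 \<le> K" "0 \<le> t" and i: "i \<in> {1..n-1}"
    and le: "\<And>s j. 0 \<le> s \<Longrightarrow> s \<le> t \<Longrightarrow> j \<in> {1..n-1} \<Longrightarrow> \<bar>u s j - v s j\<bar> \<le> K * exp (rate * s)"
  shows "\<bar>reflected u i t - reflected v i t\<bar> \<le> K * exp (rate * t) / 2"
proof -
  have *: "\<bar>drift_int u i s - drift_int v i s\<bar> \<le> K * exp (rate * t) / 4" if "0 \<le> s" "s \<le> t" for s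
  proof -
    have "\<bar>drift_int u i s - drift_int v i s\<bar> \<le> K * exp (rate * s) / 4"
      using that le by (intro abs_drift_int_diff_le u v \<open>0 \<le> K\<close>) auto
    also have "\<dots> \<le> K * exp (rate * t) / 4"
      using that \<open>0 \<le> K\<close> rate_pos by (intro divide_right_mono mult_left_mono) auto
    finally show ?thesis .
  qed
  have "\<bar>running_max (obstacle u i) t - running_max (obstacle v i) t\<bar> \<le> K * exp (rate * t) / 4"
    using * \<open>0 \<le> K\<close> by (intro running_max_diff_le continuous_on_obstacle u v i)
      (auto simp: obstacle_def abs_minus_commute)
  then show ?thesis
    using *[OF \<open>0 \<le> t\<close> order_refl] unfolding reflected_def by linarith
qed

text \<open>Maximise the weighted difference over the compact interval \<open>{0..t}\<close> and the
  finitely many indices. At a maximiser the contraction estimate yields \<open>K \<le> K / 2\<close>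
  for the maximum \<open>K\<close>, so the paths agree up to time \<open>t\<close>.\<close>

lemma reflected_fixpoint_unique:
  assumes u: "cont u" and v: "cont v"
    and fu: "\<And>t i. 0 \<le> t \<Longrightarrow> i \<in> {1..n-1} \<Longrightarrow> u t i = reflected u i t"
    and fv: "\<And>t i. 0 \<le> t \<Longrightarrow> i \<in> {1..n-1} \<Longrightarrow> v t i = reflected v i t"
    and "0 \<le> t" "i \<in> {1..n-1}"
  shows "u t i = v t i"
proof -
  define d where "d j s = \<bar>u s j - v s j\<bar> * exp (- rate * s)" for j s
  have "\<exists>s\<in>{0..t}. \<forall>r\<in>{0..t}. d j r \<le> d j s" if "j \<in> {1..n-1}" for j
  proof (rule continuous_attains_sup)
    show "continuous_on {0..t} (d j)"
      unfolding d_def using u v that by (intro continuous_intros cont_subset) auto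
  qed (use \<open>0 \<le> t\<close> in auto)
  then obtain s where s: "\<And>j. j \<in> {1..n-1} \<Longrightarrow> s j \<in> {0..t}"
    "\<And>j r. j \<in> {1..n-1} \<Longrightarrow> r \<in> {0..t} \<Longrightarrow> d j r \<le> d j (s j)"
    by metis
  \<comment> \<open>The maximum is attained since \<open>n \<ge> 2\<close> makes the index set
    nonempty.\<close>
  have "Max ((\<lambda>j. d j (s j)) ` {1..n-1}) \<in> (\<lambda>j. d j (s j)) ` {1..n-1}"
    using n by (intro Max_in) auto
  then obtain k where k: "k \<in> {1..n-1}" "Max ((\<lambda>j. d j (s j)) ` {1..n-1}) = d k (s k)"
    by auto
  define K where "K = d k (s k)"
  have "0 \<le> K" by (simp add: K_def d_def)
  have K: "d j r \<le> K" if "j \<in> {1..n-1}" "r \<in> {0..t}" for j r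
    using s(2)[OF that] Max_ge[of "(\<lambda>j. d j (s j)) ` {1..n-1}" "d j (s j)"] that(1) k(2)
    unfolding K_def by fastforce
  have le: "\<bar>u r j - v r j\<bar> \<le> K * exp (rate * r)" if "0 \<le> r" "r \<le> t" "j \<in> {1..n-1}" for r j
    using K[of j r] that by (simp add: d_def exp_minus field_simps)
  have "\<bar>u (s k) k - v (s k) k\<bar> \<le> K * exp (rate * s k) / 2"
    using s(1)[OF k(1)] fu[of "s k" k] fv[of "s k" k] k(1)
      abs_reflected_diff_le[OF u v \<open>0 \<le> K\<close> _ k(1), of "s k"] le by auto
  then have "K \<le> K / 2"
    by (simp add: K_def d_def exp_minus field_simps)
  then have "K = 0" using \<open>0 \<le> K\<close> by simp
  then show ?thesis using le[of t i] assms(5,6) by simp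
qed

end

section \<open>Existence by the Banach fixed-point theorem in a weighted norm\<close>

text \<open>Slices over the points of a discrete factor are open and cover the product, so
  continuity can be checked slice by slice.\<close>

lemma continuous_on_prod_discrete:
  fixes f :: "'a::topological_space \<times> 'b discrete \<Rightarrow> 'c::topological_space"
  assumes "\<And>i. continuous_on UNIV (\<lambda>t. f (t, discrete i))"
  shows "continuous_on UNIV f"
proof -
  have "continuous_on (\<Union>i\<in>UNIV. UNIV \<times> {discrete i}) f"
  proof (rule continuous_on_open_UN)
    show "continuous_on (UNIV \<times> {discrete i}) f" for i
    proof (rule continuous_on_eq)
      show "continuous_on (UNIV \<times> {discrete i}) (\<lambda>x. f (fst x, discrete i))"
        by (intro continuous_on_compose2[OF assms] continuous_intros) auto
    qed auto
  qed (auto intro: open_Times Discrete_Topology.open_discrete)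
  moreover have "(\<Union>i\<in>UNIV. UNIV \<times> {discrete i}) = (UNIV :: ('a \<times> 'b discrete) set)"
    by (auto intro: discrete_cases)
  ultimately show ?thesis by simp
qed

context skorohod_problem
begin

text \<open>In the norm weighted by \<open>weight\<close> the map \<open>reflected\<close> contracts by the factor \<open>1/2\<close>. The factor
  \<open>growth\<close> dominates the image of the zero path, so that the map preserves the globally bounded paths
  although \<open>V\<close> may grow arbitrarily fast; its monotonicity keeps the contraction intact.\<close>

definition growth :: "real \<Rightarrow> real" where
  "growth t = 1 + (\<Sum>i=1..n-1. running_max (\<lambda>s. \<bar>reflected (\<lambda>_ _. 0) i s\<bar>) t)"

definition weight :: "real \<Rightarrow> real" where
  "weight t = exp (rate * t) * growth t"

lemma cont_0: "cont (\<lambda>_ _. 0)"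
  by (simp add: cont_def)

lemma continuous_on_abs_reflected_0:
  "i \<in> {1..n-1} \<Longrightarrow> continuous_on {0..} (\<lambda>s. \<bar>reflected (\<lambda>_ _. 0) i s\<bar>)"
  by (intro continuous_intros continuous_on_reflected cont_0)

lemma growth_ge_1: "growth t \<ge> 1"
  unfolding growth_def using running_max_nonneg[OF continuous_on_abs_reflected_0]
  by (auto intro: sum_nonneg)

lemma growth_mono: "s \<le> t \<Longrightarrow> growth s \<le> growth t"
  unfolding growth_def using running_max_mono[OF continuous_on_abs_reflected_0]
  by (auto intro: sum_mono)

lemma abs_reflected_0_le_growth:
  assumes "0 \<le> t" and i: "i \<in> {1..n-1}"
  shows "\<bar>reflected (\<lambda>_ _. 0) i t\<bar> \<le> growth t"
proof -
  have "\<bar>reflected (\<lambda>_ _. 0) i t\<bar> \<le> running_max (\<lambda>s. \<bar>reflected (\<lambda>_ _. 0) i s\<bar>) t"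
    using running_max_upper[OF continuous_on_abs_reflected_0[OF i] \<open>0 \<le> t\<close> order_refl] .
  also have "\<dots> \<le> (\<Sum>i=1..n-1. running_max (\<lambda>s. \<bar>reflected (\<lambda>_ _. 0) i s\<bar>) t)"
    using i running_max_nonneg[OF continuous_on_abs_reflected_0]
    by (intro member_le_sum) auto
  finally show ?thesis by (simp add: growth_def)
qed

text \<open>Continuity holds across time 0 as well, because the reflected zero path starts at
  0.\<close>

lemma continuous_on_weight: "continuous_on S weight"
proof -
  have "continuous_on S (running_max (\<lambda>s. \<bar>reflected (\<lambda>_ _. 0) i s\<bar>))" if "i \<in> {1..n-1}" for i
    by (rule continuous_on_subset[OF continuous_on_running_max[OF continuous_on_abs_reflected_0[OF that]]])
      (simp_all add: reflected_0 cont_0 that[simplified])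
  then show ?thesis
    unfolding weight_def growth_def by (intro continuous_intros)
qed

lemma weight_pos: "weight t > 0"
  using growth_ge_1[of t] by (simp add: weight_def)

text \<open>Indices live in \<open>nat discrete\<close> because bounded continuous functions form a complete space only
  over a metric domain, and \<open>nat\<close> is not an instance of \<open>metric_space\<close>.\<close>

definition scaled :: "((real \<times> nat discrete) \<Rightarrow>\<^sub>C real) \<Rightarrow> real \<Rightarrow> nat \<Rightarrow> real" where
  "scaled \<phi> t i = weight t * apply_bcontfun \<phi> (t, discrete i)"

text \<open>The map \<open>reflected\<close> in coordinates divided by \<open>weight\<close>.
  Clamping time at 0 and setting the value 0 at indices out of range make it total on the domain of
  the bounded continuous functions.\<close>

definition step_fun :: "((real \<times> nat discrete) \<Rightarrow>\<^sub>C real) \<Rightarrow> real \<times> nat discrete \<Rightarrow> real" where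
  "step_fun \<phi> = (\<lambda>(t, k). let i = of_discrete k in
     if i \<in> {1..n-1} then reflected (scaled \<phi>) i (max 0 t) / weight (max 0 t) else 0)"

lemma step_fun_apply:
  "step_fun \<phi> (t, discrete i) =
     (if i \<in> {1..n-1} then reflected (scaled \<phi>) i (max 0 t) / weight (max 0 t) else 0)"
  by (simp add: step_fun_def discrete_inverse)

lemma cont_scaled: "cont (scaled \<phi>)"
  unfolding cont_def scaled_def
  by (intro ballI continuous_intros continuous_on_weight
        continuous_on_compose2[OF continuous_on_apply_bcontfun[of UNIV \<phi>]]) auto

text \<open>Up to time \<open>t\<close>, monotonicity bounds \<open>growth s\<close> by
  \<open>growth t\<close>, which is then a constant and can be absorbed into the \<open>K\<close> of
  \<open>abs_reflected_diff_le\<close>.\<close>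

lemma abs_reflected_scaled_diff_le:
  assumes "0 \<le> t" "i \<in> {1..n-1}" and v: "cont v" and "0 \<le> c"
    and le: "\<And>s j. \<bar>scaled \<phi> s j - v s j\<bar> \<le> c * weight s"
  shows "\<bar>reflected (scaled \<phi>) i t - reflected v i t\<bar> \<le> c / 2 * weight t"
proof -
  have "0 \<le> c * growth t" using \<open>0 \<le> c\<close> growth_ge_1[of t] by simp
  moreover have "\<bar>scaled \<phi> s j - v s j\<bar> \<le> c * growth t * exp (rate * s)" if "s \<le> t" for s j
  proof -
    have "c * weight s \<le> c * (exp (rate * s) * growth t)"
      unfolding weight_def using \<open>0 \<le> c\<close> growth_mono[OF that] by (intro mult_left_mono) auto
    then show ?thesis using le[of s j] by (simp add: mult_ac)
  qed
  ultimately have "\<bar>reflected (scaled \<phi>) i t - reflected v i t\<bar> \<le> c * growth t * exp (rate * t) / 2"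
    using assms by (intro abs_reflected_diff_le cont_scaled) auto
  then show ?thesis by (simp add: weight_def mult_ac)
qed

text \<open>In the bound \<open>1 + norm \<phi> / 2\<close>, the 1 accounts for the image of the
  zero path, dominated by \<open>growth\<close> and hence by \<open>weight\<close>; the rest is the
  contraction estimate against the zero path.\<close>

lemma step_fun_bcontfun: "step_fun \<phi> \<in> bcontfun"
proof (rule bcontfun_normI)
  show "continuous_on UNIV (step_fun \<phi>)"
  proof (rule continuous_on_prod_discrete)
    fix i
    show "continuous_on UNIV (\<lambda>t. step_fun \<phi> (t, discrete i))"
    proof (cases "i \<in> {1..n-1}")
      case True
      have "continuous_on UNIV (\<lambda>t. reflected (scaled \<phi>) i (max 0 t))"
        by (intro continuous_on_compose2[OF continuous_on_reflected[OF cont_scaled True]] continuous_intros) auto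
      moreover have "continuous_on UNIV (\<lambda>t. weight (max 0 t))"
        by (intro continuous_on_compose2[OF continuous_on_weight[of UNIV]] continuous_intros) auto
      ultimately show ?thesis
        using True weight_pos unfolding step_fun_apply
        by (auto intro!: continuous_on_divide simp: less_imp_neq[THEN not_sym])
    next
      case False
      then have "step_fun \<phi> (t, discrete i) = 0" for t
        by (auto simp: step_fun_apply)
      then show ?thesis by simp
    qed
  qed
  fix x :: "real \<times> nat discrete"
  obtain t i where x: "x = (t, discrete i)" by (metis discrete_cases prod.exhaust)
  show "norm (step_fun \<phi> x) \<le> 1 + norm \<phi> / 2"
  proof (cases "i \<in> {1..n-1}")
    case i: True
    define t' where "t' = max 0 t"
    have t': "0 \<le> t'" by (simp add: t'_def)
    have "\<bar>scaled \<phi> s j - 0\<bar> \<le> norm \<phi> * weight s" for s j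
      using norm_bounded[of \<phi> "(s, discrete j)"] weight_pos[of s]
      by (simp add: scaled_def abs_mult mult.commute)
    from abs_reflected_scaled_diff_le[OF t' i cont_0 _ this]
    have "\<bar>reflected (scaled \<phi>) i t' - reflected (\<lambda>_ _. 0) i t'\<bar> \<le> norm \<phi> / 2 * weight t'"
      by simp
    moreover have "growth t' \<le> weight t'"
      using growth_ge_1[of t'] rate_pos t' by (simp add: weight_def)
    ultimately have "\<bar>reflected (scaled \<phi>) i t'\<bar> \<le> (1 + norm \<phi> / 2) * weight t'"
      using abs_reflected_0_le_growth[OF t' i] unfolding distrib_right mult_1 by linarith
    then show ?thesis
      using weight_pos[of t'] i by (simp add: x step_fun_apply t'_def[symmetric] pos_divide_le_eq)
  qed (auto simp: x step_fun_apply)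
qed

lemma step_fun_contraction:
  "dist (Bcontfun (step_fun \<phi>)) (Bcontfun (step_fun \<psi>)) \<le> 1 / 2 * dist \<phi> \<psi>"
proof (rule dist_bound)
  fix x :: "real \<times> nat discrete"
  obtain t i where x: "x = (t, discrete i)" by (metis discrete_cases prod.exhaust)
  have "dist (step_fun \<phi> x) (step_fun \<psi> x) \<le> 1 / 2 * dist \<phi> \<psi>"
  proof (cases "i \<in> {1..n-1}")
    case i: True
    define t' where "t' = max 0 t"
    have t': "0 \<le> t'" by (simp add: t'_def)
    have "\<bar>scaled \<phi> s j - scaled \<psi> s j\<bar> \<le> dist \<phi> \<psi> * weight s" for s j
    proof -
      have "scaled \<phi> s j - scaled \<psi> s j = (apply_bcontfun \<phi> (s, discrete j) - apply_bcontfun \<psi> (s, discrete j)) * weight s"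
        by (simp add: scaled_def algebra_simps)
      then show ?thesis
        using dist_bounded[of \<phi> "(s, discrete j)" \<psi>] weight_pos[of s]
        by (simp add: abs_mult dist_real_def)
    qed
    from abs_reflected_scaled_diff_le[OF t' i cont_scaled _ this]
    have "\<bar>reflected (scaled \<phi>) i t' - reflected (scaled \<psi>) i t'\<bar> \<le> dist \<phi> \<psi> / 2 * weight t'"
      by simp
    moreover have "dist (step_fun \<phi> x) (step_fun \<psi> x) =
        \<bar>reflected (scaled \<phi>) i t' - reflected (scaled \<psi>) i t'\<bar> / weight t'"
      using i weight_pos[of t']
      by (simp add: x step_fun_apply t'_def[symmetric] dist_real_def flip: diff_divide_distrib)
    ultimately show ?thesis
      using weight_pos[of t'] by (simp add: pos_divide_le_eq)
  qed (auto simp: x step_fun_apply)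
  then show "dist (apply_bcontfun (Bcontfun (step_fun \<phi>)) x) (apply_bcontfun (Bcontfun (step_fun \<psi>)) x) \<le> 1 / 2 * dist \<phi> \<psi>"
    by (simp add: Bcontfun_inverse step_fun_bcontfun)
qed

text \<open>Multiplying the Banach fixed point by \<open>weight\<close> undoes the division in
  \<open>step_fun\<close>.\<close>

lemma reflected_fixpoint_exists:
  obtains u where "cont u" "\<And>t i. 0 \<le> t \<Longrightarrow> i \<in> {1..n-1} \<Longrightarrow> u t i = reflected u i t"
proof -
  obtain \<phi> where \<phi>: "Bcontfun (step_fun \<phi>) = \<phi>"
    using banach_fix_type[of "1 / 2" "\<lambda>\<phi>. Bcontfun (step_fun \<phi>)"] step_fun_contraction by auto
  have "scaled \<phi> t i = reflected (scaled \<phi>) i t" if "0 \<le> t" "i \<in> {1..n-1}" for t i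
  proof -
    have "apply_bcontfun \<phi> (t, discrete i) = step_fun \<phi> (t, discrete i)"
      using Bcontfun_inverse[OF step_fun_bcontfun[of \<phi>]] \<phi> by simp
    also have "\<dots> = reflected (scaled \<phi>) i t / weight t"
      using that by (simp add: step_fun_apply)
    finally show ?thesis
      using weight_pos[of t] by (simp add: scaled_def)
  qed
  then show ?thesis using that cont_scaled by blast
qed

end

theorem theorem3p1:
  fixes n :: nat and V :: "real \<Rightarrow> nat \<Rightarrow> real"
  assumes "n \<ge> 2"
    and "V \<in> path_space n"
    and "\<forall>i\<in>{1..n-1}. V 0 i \<ge> 0"
  shows "\<exists>!Z\<eta>. skorohod_solution n V Z\<eta>"
proof -
  interpret skorohod_problem n V
    using assms by unfold_locales auto
  obtain u where u: "cont u" "\<And>t i. 0 \<le> t \<Longrightarrow> i \<in> {1..n-1} \<Longrightarrow> u t i = reflected u i t"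
    using reflected_fixpoint_exists by blast
  \<comment> \<open>The fixed point is a total function; restricting it makes it extensional and
    leaves its drift integral and obstacle unchanged.\<close>
  define Z where "Z = restrict_path u"
  define \<eta> where "\<eta> = restrict_path (\<lambda>t i. running_max (obstacle u i) t)"
  have Z: "Z t i = u t i" if "0 \<le> t" "i \<in> {1..n-1}" for t i
    unfolding Z_def using that by (rule restrict_path_apply)
  have "obstacle Z = obstacle u" "drift_int Z = drift_int u"
    using Z by (intro obstacle_cong drift_int_cong; simp)+
  moreover have "Z \<in> path_space n" "\<eta> \<in> path_space n"
    unfolding Z_def \<eta>_def using u(1) continuous_on_running_max_obstacle[OF u(1)]
    by (auto intro!: restrict_path_in_path_space simp: cont_def)
  ultimately have ex: "skorohod_solution n V (Z, \<eta>)"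
    using Z u(2) by (auto simp: skorohod_solution_iff \<eta>_def reflected_def)
  \<comment> \<open>Both first components are fixed points of \<open>reflected\<close> and hence
    agree; the second components are then running maxima of the same obstacle.\<close>
  have "Z' = Z \<and> \<eta>' = \<eta>" if sol: "skorohod_solution n V (Z', \<eta>')" for Z' \<eta>'
  proof
    note S = sol[unfolded skorohod_solution_iff] and E = ex[unfolded skorohod_solution_iff]
    have path: "Z' \<in> path_space n" "Z \<in> path_space n" "\<eta>' \<in> path_space n" "\<eta> \<in> path_space n"
      using S E by blast+
    show "Z' = Z"
      using path(1,2)
    proof (rule path_space_eqI)
      fix t :: real and i assume "0 \<le> t" "i \<in> {1..n-1}"
      then show "Z' t i = Z t i"
        by (rule reflected_fixpoint_unique[OF path(1,2)[THEN cont_path_space], rotated 2])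
          (use S E in blast)+
    qed
    show "\<eta>' = \<eta>"
      using path(3,4)
    proof (rule path_space_eqI)
      fix t :: real and i assume "0 \<le> t" "i \<in> {1..n-1}"
      then show "\<eta>' t i = \<eta> t i"
        using S E unfolding \<open>Z' = Z\<close> by metis
    qed
  qed
  then have "p = (Z, \<eta>)" if "skorohod_solution n V p" for p
    using that by (metis surj_pair)
  with ex show ?thesis by (rule ex1I)
qed

end
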